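(* Let $\mathbf{A} \in \mathbb{R}^{n\times n}$ be a symmetric matrix with a splitting $\mathbf{A} = \mathbf{M} - \mathbf{N}$, where $\mathbf{M} = \mathbf{M}^\mathsf{T} \in \mathbb{R}^{n \times n}$ is nonsingular. Let $\ell \in \mathbb{N}$ ($\ell \ge 1$), $\mathbf{H} = \mathbf{M}^{-1}\mathbf{N}$, and $\mathbf{C}^{(\ell)} = \sum_{i=0}^{\ell-1} \mathbf{H}^i \mathbf{M}^{-1}$. Then the following hold. 1. $\mathbf{C}^{(\ell)}$ is symmetric. 2. For $\ell$ odd, $\mathbf{C}^{(\ell)}$ is positive definite if and only if $\mathbf{M}$ is positive definite. 3. For $\ell$ even, $\mathbf{C}^{(\ell)}$ is positive definite if and only if $\mathbf{M} + \mathbf{N}$ is positive definite.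
   Context: All matrices are real. The matrix $\mathbf{A}$ may be singular and indefinite. A splitting of $\mathbf{A}$ is a decomposition $\mathbf{A} = \mathbf{M} - \mathbf{N}$ with $\mathbf{M}$ nonsingular. A symmetric matrix $\mathbf{S}$ is positive definite if $\mathbf{v}^\mathsf{T}\mathbf{S}\mathbf{v} > 0$ for all $\mathbf{v} \neq \mathbf{0}$. *)

theory Defs
  imports "HOL-Analysis.Analysis"
begin

definition symmetric_matrix :: "real^'n^'n \<Rightarrow> bool" where
  "symmetric_matrix S \<longleftrightarrow> transpose S = S"

definition positive_definite :: "real^'n^'n \<Rightarrow> bool" where
  "positive_definite S \<longleftrightarrow> symmetric_matrix S \<and> (\<forall>v. v \<noteq> 0 \<longrightarrow> v \<bullet> (S *v v) > 0)"

definition splitting :: "real^'n^'n \<Rightarrow> real^'n^'n \<Rightarrow> real^'n^'n \<Rightarrow> bool" where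
  "splitting A M N \<longleftrightarrow> A = M - N \<and> invertible M"

(* Powers with respect to the matrix product **; the operations * and ^ inherited by vectors
   are componentwise. *)
primrec matrix_power :: "real^'n^'n \<Rightarrow> nat \<Rightarrow> real^'n^'n" where
  "matrix_power X 0 = mat 1"
| "matrix_power X (Suc k) = X ** matrix_power X k"

definition iteration_matrix :: "real^'n^'n \<Rightarrow> real^'n^'n \<Rightarrow> real^'n^'n" where
  "iteration_matrix M N = matrix_inv M ** N"

definition C_matrix :: "nat \<Rightarrow> real^'n^'n \<Rightarrow> real^'n^'n \<Rightarrow> real^'n^'n" where
  "C_matrix l M N = (\<Sum>i<l. matrix_power (iteration_matrix M N) i ** matrix_inv M)"

end

theory Submission
  imports Defs
begin

text \<open>
  Put \<open>S = M\<^sup>-\<^sup>1\<close> if \<open>l\<close> is odd and \<open>S = (I + H) M\<^sup>-\<^sup>1 = M\<^sup>-\<^sup>1 (M + N) M\<^sup>-\<^sup>1\<close> if \<open>l\<close> is even. Then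
  \<open>S\<close> is symmetric, \<open>H S = S H\<^sup>T\<close>, and \<open>C = K S\<close> where \<open>K\<close> is a polynomial in \<open>H\<close> that is a sum of
  squares including a positive constant: for \<open>l = 2m\<close> it is \<open>\<Sum>j<m. (H\<^sup>j)\<^sup>2\<close>, and for \<open>l = 2m+1\<close>
  we have \<open>2K = I + (H\<^sup>m)\<^sup>2 + (\<Sum>j<m. (H\<^sup>j (I + H))\<^sup>2)\<close>. Since \<open>Q\<^sup>2 S = Q S Q\<^sup>T\<close> for every polynomial
  \<open>Q\<close> in \<open>H\<close>, multiplication by \<open>K\<close> preserves positive definiteness. Conversely, if \<open>K S\<close> is positive
  definite, then so is \<open>K (K S) = K S K\<^sup>T\<close>; hence \<open>K\<close> is invertible and \<open>S\<close> is positive definite by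
  congruence.
\<close>

section \<open>Matrix inverses and the intertwining relation
  \<open>Q ** S = S ** transpose Q\<close>\<close>

lemma matrix_add_rdistrib: "(A + B) ** C = A ** C + B ** (C :: 'a::semiring_1^'k^'n)"
  by (simp add: matrix_matrix_mult_def vec_eq_iff distrib_right sum.distrib)

lemma matrix_inv:
  fixes M :: "'a::semiring_1^'n^'m"
  assumes "invertible M"
  shows "M ** matrix_inv M = mat 1" "matrix_inv M ** M = mat 1"
  using someI_ex[OF assms[unfolded invertible_def]] by (simp_all add: matrix_inv_def)

text \<open>Moving \<open>R\<close> and then \<open>Q\<close> past \<open>S\<close> leaves the
  transpose of \<open>R ** Q\<close>; commutativity turns this into the transpose of
  \<open>Q ** R\<close>.\<close>

lemma intertwine_mult:
  fixes Q R :: "real^'n^'n"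
  assumes "Q ** S = S ** transpose Q" "R ** S = S ** transpose R" "Q ** R = R ** Q"
  shows "(Q ** R) ** S = S ** transpose (Q ** R)"
proof -
  have "(Q ** R) ** S = Q ** (S ** transpose R)" by (simp add: assms(2) flip: matrix_mul_assoc)
  also have "\<dots> = S ** (transpose Q ** transpose R)"
    by (simp add: assms(1) matrix_mul_assoc)
  also have "transpose Q ** transpose R = transpose (Q ** R)"
    by (simp add: assms(3) matrix_transpose_mul)
  finally show ?thesis .
qed

lemma transpose_zero: "transpose 0 = (0 :: real^'n^'m)"
  by (simp add: transpose_def vec_eq_iff)

lemma transpose_add: "transpose (Q + R) = transpose Q + transpose (R :: real^'n^'m)"
  by (simp add: transpose_def vec_eq_iff)

lemma transpose_diff: "transpose (Q - R) = transpose Q - transpose (R :: real^'n^'m)"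
  by (simp add: transpose_def vec_eq_iff)

lemma intertwine_add:
  fixes Q R :: "real^'n^'n"
  assumes "Q ** S = S ** transpose Q" "R ** S = S ** transpose R"
  shows "(Q + R) ** S = S ** transpose (Q + R)"
  using assms by (simp add: transpose_add matrix_add_ldistrib matrix_add_rdistrib)

lemma matrix_power_commute:
  assumes "H ** K = K ** H"
  shows "matrix_power H i ** K = K ** matrix_power H i"
proof (induction i)
  case (Suc i)
  have "matrix_power H (Suc i) ** K = H ** (K ** matrix_power H i)"
    by (simp add: Suc flip: matrix_mul_assoc)
  then show ?case by (simp add: assms matrix_mul_assoc)
qed simp

lemma matrix_power_intertwine:
  assumes "H ** S = S ** transpose H"
  shows "matrix_power H i ** S = S ** transpose (matrix_power H i)"
proof (induction i)
  case (Suc i)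
  then show ?case
    using intertwine_mult[OF assms Suc] matrix_power_commute[of H H i] by simp
qed simp

lemma matrix_power_double: "matrix_power H (2 * m) = matrix_power H m ** matrix_power H m"
proof (induction m)
  case (Suc m)
  have "matrix_power H m ** H = H ** matrix_power H m" by (simp add: matrix_power_commute)
  with Suc show ?case by simp (metis matrix_mul_assoc)
qed simp

section \<open>Geometric sums and their decomposition into squares\<close>

definition geometric_sum :: "real^'n^'n \<Rightarrow> nat \<Rightarrow> real^'n^'n" where
  "geometric_sum H l = (\<Sum>i<l. matrix_power H i)"

text \<open>The even powers are written as products of equal factors, so that each term is visibly a
  square.\<close>

definition even_geometric_sum :: "real^'n^'n \<Rightarrow> nat \<Rightarrow> real^'n^'n" where
  "even_geometric_sum H m = (\<Sum>j<m. matrix_power H j ** matrix_power H j)"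

lemma C_matrix_eq: "C_matrix l M N = geometric_sum (iteration_matrix M N) l ** matrix_inv M"
  unfolding C_matrix_def geometric_sum_def
  by (induction l) (simp_all add: matrix_add_rdistrib)

lemma geometric_sum_commute: "H ** geometric_sum H l = geometric_sum H l ** H"
  unfolding geometric_sum_def
  by (induction l)
    (simp_all add: matrix_add_ldistrib matrix_add_rdistrib matrix_power_commute)

lemma even_geometric_sum_commute: "H ** even_geometric_sum H l = even_geometric_sum H l ** H"
  unfolding even_geometric_sum_def
proof (induction l)
  case (Suc l)
  have "H ** (matrix_power H l ** matrix_power H l) = matrix_power H l ** matrix_power H l ** H"
    by (metis matrix_power_commute matrix_mul_assoc)
  with Suc show ?case by (simp add: matrix_add_ldistrib matrix_add_rdistrib)
qed simp

lemma geometric_sum_intertwine: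
  assumes "H ** S = S ** transpose H"
  shows "geometric_sum H l ** S = S ** transpose (geometric_sum H l)"
  unfolding geometric_sum_def
  by (induction l)
    (simp_all add: transpose_zero intertwine_add matrix_power_intertwine[OF assms])

lemma even_geometric_sum_intertwine:
  assumes "H ** S = S ** transpose H"
  shows "even_geometric_sum H l ** S = S ** transpose (even_geometric_sum H l)"
  unfolding even_geometric_sum_def
proof (induction l)
  case (Suc l)
  have "(matrix_power H l ** matrix_power H l) ** S = S ** transpose (matrix_power H l ** matrix_power H l)"
    by (intro intertwine_mult matrix_power_intertwine assms refl)
  with Suc show ?case by (simp add: intertwine_add)
qed (simp add: transpose_zero)

text \<open>The powers with exponents \<open>2 * j\<close> and \<open>2 * j + 1\<close> are paired,
  which leaves the factor \<open>mat 1 + H\<close>.\<close>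

lemma geometric_sum_even:
  "geometric_sum H (2 * m) = even_geometric_sum H m ** (mat 1 + H)"
proof (induction m)
  case 0 then show ?case by (simp add: geometric_sum_def even_geometric_sum_def)
next
  case (Suc m)
  have "geometric_sum H (2 * Suc m)
      = geometric_sum H (2 * m) + matrix_power H (2 * m) + matrix_power H (2 * m) ** H"
    by (simp add: geometric_sum_def matrix_power_commute)
  with Suc matrix_power_double[of H m] show ?case
    by (simp add: even_geometric_sum_def matrix_add_ldistrib matrix_add_rdistrib)
qed

text \<open>The \<open>j\<close>-th square contributes the powers \<open>2 * j\<close>,
  \<open>2 * j + 1\<close>, \<open>2 * j + 2\<close> of \<open>H\<close> with weights 1, 2, 1.
  Neighbouring squares overlap in an even power, so only the end powers 0 and \<open>2 * m\<close>
  need one extra copy.\<close>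

lemma geometric_sum_odd:
  "geometric_sum H (2 * m + 1) + geometric_sum H (2 * m + 1)
    = mat 1 + matrix_power H m ** matrix_power H m
      + (\<Sum>j<m. (matrix_power H j ** (mat 1 + H)) ** (matrix_power H j ** (mat 1 + H)))"
proof (induction m)
  case 0 then show ?case by (simp add: geometric_sum_def)
next
  case (Suc m)
  let ?P = "matrix_power H m"
  have c: "?P ** H = H ** ?P" by (simp add: matrix_power_commute)
  \<comment> \<open>Under left association \<open>?P ** H\<close> also occurs behind a prefix
    \<open>X\<close>; this form lets the simplifier move every \<open>H\<close> to the left there
    too.\<close>
  have c': "X ** ?P ** H = X ** H ** ?P" for X using c by (metis matrix_mul_assoc)
  have "geometric_sum H (2 * Suc m + 1)
      = geometric_sum H (2 * m + 1) + H ** ?P ** ?P + H ** H ** ?P ** ?P"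
    by (simp add: geometric_sum_def matrix_power_double matrix_mul_assoc)
  moreover have "matrix_power H (Suc m) ** matrix_power H (Suc m) = H ** H ** ?P ** ?P"
    by (simp add: c c' matrix_mul_assoc)
  moreover have "(?P ** (mat 1 + H)) ** (?P ** (mat 1 + H))
      = ?P ** ?P + H ** ?P ** ?P + H ** ?P ** ?P + H ** H ** ?P ** ?P"
    by (simp add: matrix_add_ldistrib matrix_add_rdistrib c c' matrix_mul_assoc)
  ultimately show ?case using Suc by (simp add: algebra_simps)
qed

section \<open>Quadratic forms and congruence\<close>

lemma quadratic_form_congruence:
  fixes P X :: "real^'n^'n"
  shows "v \<bullet> ((transpose P ** X ** P) *v v) = (P *v v) \<bullet> (X *v (P *v v))"
proof -
  have "v \<bullet> (transpose P *v w) = (P *v v) \<bullet> w" for w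
    by (metis transpose_matrix_vector dot_lmul_matrix inner_commute)
  then show ?thesis by (simp flip: matrix_vector_mul_assoc)
qed

text \<open>One factor \<open>Q\<close> crosses \<open>S\<close>, so the form at \<open>v\<close> is
  that of \<open>S\<close> at \<open>transpose Q *v v\<close>. This vector may vanish, hence only a
  weak inequality.\<close>

lemma quadratic_form_square_nonneg:
  fixes Q S :: "real^'n^'n"
  assumes "positive_definite S" "Q ** S = S ** transpose Q"
  shows "v \<bullet> ((Q ** Q ** S) *v v) \<ge> 0"
proof -
  have "Q ** Q ** S = transpose (transpose Q) ** S ** transpose Q"
    using assms(2) by (metis matrix_mul_assoc transpose_transpose)
  then have "v \<bullet> ((Q ** Q ** S) *v v) = (transpose Q *v v) \<bullet> (S *v (transpose Q *v v))"
    using quadratic_form_congruence by metis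
  then show ?thesis using assms(1)
    by (cases "transpose Q *v v = 0") (auto simp: positive_definite_def less_imp_le)
qed

lemma positive_definite_imp_invertible:
  fixes S :: "real^'n^'n"
  assumes "positive_definite S"
  shows "invertible S"
proof -
  have "x = 0" if "S *v x = 0" for x
    using assms that unfolding positive_definite_def by (metis inner_zero_right less_irrefl)
  then show ?thesis
    by (metis invertible_left_inverse matrix_left_invertible_ker)
qed

lemma positive_definite_congruence:
  fixes P X :: "real^'n^'n"
  assumes P: "invertible P" and X: "symmetric_matrix X"
  shows "positive_definite (transpose P ** X ** P) \<longleftrightarrow> positive_definite X"
proof
  have sym: "symmetric_matrix (transpose P ** X ** P)"
    using X by (simp add: symmetric_matrix_def matrix_transpose_mul matrix_mul_assoc)
  have ker: "P *v v = 0 \<longleftrightarrow> v = 0" for v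
    using P by (metis invertible_left_inverse matrix_left_invertible_ker matrix_vector_mult_0_right)
  show "positive_definite (transpose P ** X ** P)" if "positive_definite X"
    using that sym ker by (simp add: positive_definite_def quadratic_form_congruence)
  show "positive_definite X" if pd: "positive_definite (transpose P ** X ** P)"
  proof -
    have "v \<bullet> (X *v v) > 0" if "v \<noteq> 0" for v
    proof -
      obtain w where w: "v = P *v w"
        using P by (metis invertible_right_inverse matrix_right_invertible_surjective surjD)
      with \<open>v \<noteq> 0\<close> have "w \<noteq> 0" by auto
      then show ?thesis
        using pd w by (simp add: positive_definite_def quadratic_form_congruence)
    qed
    with X show ?thesis by (simp add: positive_definite_def)
  qed
qed

section \<open>Transfer of definiteness through a multiplier\<close>

lemma symmetric_matrix_intertwine:
  assumes "symmetric_matrix S" "K ** S = S ** transpose K"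
  shows "symmetric_matrix (K ** S)"
  using assms by (simp add: symmetric_matrix_def matrix_transpose_mul)

text \<open>An abstract \<open>K\<close> serves both parities. The premise \<open>pres\<close>
  ranges over all \<open>S\<close> because the converse applies it to \<open>K ** S\<close>.\<close>

lemma positive_definite_multiplier_iff:
  fixes H K S :: "real^'n^'n"
  assumes pres: "\<And>S. positive_definite S \<Longrightarrow> H ** S = S ** transpose H \<Longrightarrow> positive_definite (K ** S)"
    and comm: "H ** K = K ** H"
    and S: "symmetric_matrix S" "H ** S = S ** transpose H"
  shows "positive_definite (K ** S) \<longleftrightarrow> positive_definite S"
proof
  assume pd: "positive_definite (K ** S)"
  then have KS: "K ** S = S ** transpose K"
    using S(1) by (metis positive_definite_def symmetric_matrix_def matrix_transpose_mul)
  have "H ** (K ** S) = (K ** S) ** transpose H"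
    using comm S(2) by (metis matrix_mul_assoc)
  then have pd2: "positive_definite (K ** (K ** S))" by (rule pres[OF pd])
  have eq: "K ** (K ** S) = transpose (transpose K) ** S ** transpose K"
    using KS by (metis matrix_mul_assoc transpose_transpose)
  \<comment> \<open>\<open>K\<close> is the left factor of an invertible square matrix, so it has a
    right inverse.\<close>
  have "invertible K"
    using positive_definite_imp_invertible[OF pd2]
    by (metis invertible_right_inverse matrix_mul_assoc)
  then have "invertible (transpose K)" by (rule transpose_invertible)
  then show "positive_definite S"
    using pd2 positive_definite_congruence[OF _ S(1)] unfolding eq by blast
qed (rule pres[OF _ S(2)])

section \<open>Positivity of the two multipliers\<close>

lemma quadratic_form_sum_nonneg:
  fixes X :: "nat \<Rightarrow> real^'n^'n" and v :: "real^'n"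
  assumes "\<And>j. v \<bullet> ((X j ** S) *v v) \<ge> 0"
  shows "v \<bullet> (((\<Sum>j<m. X j) ** S) *v v) \<ge> 0"
  by (induction m)
    (use assms in \<open>simp_all add: matrix_add_rdistrib matrix_vector_mult_add_rdistrib inner_add_right\<close>)

lemma positive_definite_even_geometric_sum:
  fixes H S :: "real^'n^'n"
  assumes S: "positive_definite S" "H ** S = S ** transpose H" and "m > 0"
  shows "positive_definite (even_geometric_sum H m ** S)"
proof -
  \<comment> \<open>The term \<open>j = 0\<close> is the identity; split off, it contributes
    \<open>S\<close> itself and makes the inequality strict.\<close>
  obtain k where m: "m = Suc k" using \<open>m > 0\<close> gr0_implies_Suc by blast
  let ?X = "\<lambda>j. matrix_power H (Suc j) ** matrix_power H (Suc j)"
  have "even_geometric_sum H m = mat 1 + (\<Sum>j<k. ?X j)"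
    unfolding even_geometric_sum_def m sum.lessThan_Suc_shift by simp
  moreover have "v \<bullet> (((\<Sum>j<k. ?X j) ** S) *v v) \<ge> 0" for v
    by (intro quadratic_form_sum_nonneg quadratic_form_square_nonneg S matrix_power_intertwine)
  moreover have "symmetric_matrix (even_geometric_sum H m ** S)"
    using S by (intro symmetric_matrix_intertwine even_geometric_sum_intertwine)
      (simp_all add: positive_definite_def)
  ultimately show ?thesis
    using S(1) by (simp add: positive_definite_def matrix_add_rdistrib
        matrix_vector_mult_add_rdistrib inner_add_right add_pos_nonneg)
qed

lemma positive_definite_odd_geometric_sum:
  fixes H S :: "real^'n^'n"
  assumes S: "positive_definite S" "H ** S = S ** transpose H"
  shows "positive_definite (geometric_sum H (2 * m + 1) ** S)"
proof -
  let ?G = "geometric_sum H (2 * m + 1)" and ?P = "matrix_power H m"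
  let ?Q = "\<lambda>j. matrix_power H j ** (mat 1 + H)"
  let ?R = "\<Sum>j<m. ?Q j ** ?Q j"
  have Q: "?Q j ** S = S ** transpose (?Q j)" for j
    by (intro intertwine_mult intertwine_add matrix_power_intertwine matrix_power_commute S)
      (simp_all add: matrix_add_ldistrib matrix_add_rdistrib)
  have R: "v \<bullet> ((?R ** S) *v v) \<ge> 0" for v
    by (intro quadratic_form_sum_nonneg quadratic_form_square_nonneg S Q)
  have P: "v \<bullet> ((?P ** ?P ** S) *v v) \<ge> 0" for v
    by (intro quadratic_form_square_nonneg S matrix_power_intertwine)
  have "?G ** S + ?G ** S = S + ?P ** ?P ** S + ?R ** S"
    using arg_cong[OF geometric_sum_odd[of H m], of "\<lambda>X. X ** S"]
    by (simp only: matrix_add_rdistrib matrix_mul_lid)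
  from arg_cong[OF this, of "\<lambda>X. v \<bullet> (X *v v)" for v]
  have eq: "2 * (v \<bullet> ((?G ** S) *v v))
      = v \<bullet> (S *v v) + v \<bullet> ((?P ** ?P ** S) *v v) + v \<bullet> ((?R ** S) *v v)" for v
    by (simp only: matrix_vector_mult_add_rdistrib inner_add_right mult_2)
  have "v \<bullet> ((?G ** S) *v v) > 0" if "v \<noteq> 0" for v
  proof -
    have "v \<bullet> (S *v v) > 0" using S(1) that by (simp add: positive_definite_def)
    with eq[of v] R[of v] P[of v] show ?thesis by linarith
  qed
  moreover have "symmetric_matrix (?G ** S)"
    using S by (intro symmetric_matrix_intertwine geometric_sum_intertwine)
      (simp_all add: positive_definite_def)
  ultimately show ?thesis by (simp add: positive_definite_def)
qed

theorem theorem2p6: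
  fixes A M N :: "real^'n^'n" and l :: nat
  assumes "symmetric_matrix A"
    and "splitting A M N"
    and "symmetric_matrix M"
    and "l \<ge> 1"
  shows "symmetric_matrix (C_matrix l M N)
    \<and> (odd l \<longrightarrow> (positive_definite (C_matrix l M N) \<longleftrightarrow> positive_definite M))
    \<and> (even l \<longrightarrow> (positive_definite (C_matrix l M N) \<longleftrightarrow> positive_definite (M + N)))"
proof -
  define V where "V = matrix_inv M"
  define H where "H = iteration_matrix M N"
  have A: "A = M - N" and inv: "invertible M"
    using assms(2) by (auto simp: splitting_def)
  have VM: "V ** M = mat 1" "M ** V = mat 1"
    using inv by (simp_all add: V_def matrix_inv)
  then have Vinv: "invertible V" unfolding invertible_def by blast
  have M: "transpose M = M" using assms(3) by (simp add: symmetric_matrix_def)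
  have "N = M - A" using A by simp
  then have N: "transpose N = N"
    using assms(1) M by (simp add: transpose_diff symmetric_matrix_def)
  \<comment> \<open>Transposing \<open>M ** V = mat 1\<close> shows that \<open>transpose V\<close>
    is a left inverse of \<open>M\<close>, hence equal to \<open>V\<close>.\<close>
  have V: "transpose V = V"
    using VM M by (metis matrix_transpose_mul transpose_mat matrix_mul_assoc matrix_mul_lid matrix_mul_rid)
  have H: "H = V ** N" by (simp add: H_def V_def iteration_matrix_def)
  \<comment> \<open>Both sides are \<open>V ** N ** V\<close>.\<close>
  have HV: "H ** V = V ** transpose H"
    by (simp add: H matrix_transpose_mul N V matrix_mul_assoc)
  have symV: "symmetric_matrix V" by (simp add: symmetric_matrix_def V)
  have C: "C_matrix l M N = geometric_sum H l ** V"
    by (simp add: C_matrix_eq H_def V_def)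
  have "symmetric_matrix (C_matrix l M N)"
    unfolding C by (intro symmetric_matrix_intertwine geometric_sum_intertwine symV HV)
  moreover have "positive_definite (C_matrix l M N) \<longleftrightarrow> positive_definite M" if "odd l"
  proof -
    obtain m where l: "l = 2 * m + 1" using \<open>odd l\<close> by (elim oddE)
    have "positive_definite (C_matrix l M N) \<longleftrightarrow> positive_definite V"
      unfolding C unfolding l
      by (intro positive_definite_multiplier_iff[where H = H] positive_definite_odd_geometric_sum
          geometric_sum_commute symV HV)
    \<comment> \<open>This makes the inverse of \<open>M\<close> congruent to
      \<open>M\<close>.\<close>
    also have "V = transpose V ** M ** V" by (simp add: V VM)
    also have "positive_definite \<dots> \<longleftrightarrow> positive_definite M"
      by (rule positive_definite_congruence[OF Vinv assms(3)])
    finally show ?thesis .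
  qed
  moreover have "positive_definite (C_matrix l M N) \<longleftrightarrow> positive_definite (M + N)" if "even l"
  proof -
    obtain m where l: "l = 2 * m" using \<open>even l\<close> by (elim evenE)
    with assms(4) have "m > 0" by simp
    define S where "S = (mat 1 + H) ** V"
    \<comment> \<open>Here \<open>H ** V = V ** N ** V\<close>, and the summand \<open>V\<close> is
      rewritten as \<open>V ** M ** V\<close>.\<close>
    have S: "S = transpose V ** (M + N) ** V"
      by (simp add: S_def H V matrix_add_ldistrib matrix_add_rdistrib VM)
    have symMN: "symmetric_matrix (M + N)"
      by (simp add: symmetric_matrix_def transpose_add M N)
    have symS: "symmetric_matrix S"
      using symMN by (simp add: S symmetric_matrix_def matrix_transpose_mul matrix_mul_assoc)
    \<comment> \<open>\<open>H\<close> commutes with \<open>mat 1 + H\<close>, so the relation for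
      \<open>V\<close> carries over to \<open>S\<close>.\<close>
    have "H ** S = (mat 1 + H) ** (H ** V)"
      by (simp add: S_def matrix_add_ldistrib matrix_add_rdistrib matrix_mul_assoc)
    then have HS: "H ** S = S ** transpose H"
      by (simp add: HV S_def matrix_mul_assoc)
    have "C_matrix l M N = even_geometric_sum H m ** S"
      unfolding C unfolding l by (simp add: geometric_sum_even S_def matrix_mul_assoc)
    then have "positive_definite (C_matrix l M N) \<longleftrightarrow> positive_definite S"
      using positive_definite_multiplier_iff[OF _ even_geometric_sum_commute symS HS]
        positive_definite_even_geometric_sum[OF _ _ \<open>m > 0\<close>] by metis
    also have "\<dots> \<longleftrightarrow> positive_definite (M + N)"
      unfolding S by (rule positive_definite_congruence[OF Vinv symMN])
    finally show ?thesis .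
  qed
  ultimately show ?thesis by blast
qed

end
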